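(* Let $\mathcal V=\{V_i\}_{i\in P}$ be a set of views that explains a strongly causal consistent execution. For each process $i\in P$ let $$R_i=\widehat{A}_i(\mathcal V)\setminus\bigl(SWO_i(\mathcal V)\cup PO\cup B_i(\mathcal V)\bigr),$$ where the union is the plain set-theoretic union and $\widehat A_i(\mathcal V)$ is the transitive reduction of $A_i(\mathcal V)$. Then $\mathcal R=\{R_i\}_{i\in P}$ is a good record of $\mathcal V$ (in the data-race sense, RnR Model 2); in particular, every set of views $\mathcal V'=\{V'_i\}_{i\in P}$ that explains some strongly causal consistent execution and satisfies $R_i\subseteq V'_i$ for all $i\in P$ has $DRO(V'_i)=DRO(V_i)$ for all $i\in P$.
   Context: Relations are sets of ordered pairs; $a<_R b$ means $(a,b)\in R$, and $a\le_R b$ means $a<_R b$ or $a=b$. Partial and total orders are strict (irreflexive, antisymmetric, transitive). $A$ respects $B$ means $B\subseteq A$. $A\mid S$ is the restriction $A\cap(S\times S)$. $\widehat A$ is the (unique) transitive reduction of a partial order $A$ on a finite set. For relations $A,B$, write $A\sqcup B$ for the transitive closure of $A\cup B$, while $\cup$ is the plain union. System. There are a finite set $P$ of processes, a finite set $X$ of shared variables and a finite set $O$ of operations. Each operation is a read or a write, performed by one process on one variable. $( *,i,*,* )$ is the set of operations of process $i$, $( *,*,x,* )$ the set of operations on variable $x$, $(\mathrm w,*,*,* )$ the set of all writes, $(\mathrm w,i,*,* )$ the set of writes of process $i$. Put $D_i=( *,i,*,* )\cup(\mathrm w,*,*,* )$. For each $i$ a total order $PO(i)$ on $( *,i,*,*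 )$ is fixed (independent of the execution), and $PO=\bigcup_i PO(i)$ (program order). Writes write pairwise distinct values. Executions and views. An execution specifies for every read the value it returns: that of some write to the same variable, or the initial default value of the variable. For an execution, a view on $D_i$ is a total order on $D_i$ in which every read returns the value of the last preceding write to the same variable (the default value if there is none). Consequently every family of total orders on the sets $D_i$, $i\in P$, is a family of views for exactly one execution. The data-race order of a view $V$ is $DRO(V)=\bigcup_{x\in X}V\mid( *,*,x,* )$. Strong causal consistency. For $\mathcal V=\{V_i\}_{i\in P}$: for a write $w^1$ and a write $w^2$ of process $i$, $(w^1,w^2)\in SCO(\mathcal V)$ iff $(w^1,w^2)\in V_i$. $\mathcal V$ explains a strongly causal consistent execution if for every $i$, $V_i$ is a view on $D_i$ for that execution and $V_i$ respects $SCO(\mathcal V)$ and $PO\mid D_i$. Strong write order. For a write $w^1$ and a write $w^2$ of process $i$: $(w^1,w^2)\in SWO^1(\mathcal V)$ iff $(w^1,w^2)\in DRO(V_i)\sqcup(PO\mid D_i)$; for $k\ge2$, $(w^1,w^2)\in SWO^k(\mathcal V)$ iff $(w^1,w^2)\in DRO(V_i)\sqcup SWO^{k-1}(\mathcal V)\sqcup(PO\mid D_i)$. $SWO(\mathcal V)=\bigcup_{k\ge1}SWO^k(\mathcal V)$. $SWO_j(\mathcal V)$ is the set of $(w^1,w^2)\in SWO(\mathcal V)$ with $w^2$ a write of a process different from $j$. $A_i(\mathcal V)=DRO(V_i)\sqcup SWO_i(\mathcal V)\sqcup(PO\mid D_i)$. Relation $C_i$. For a process $i$, an operation $o^1$ and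 a write $w^2$, define relations $C_i^k=C_i^k(\mathcal V,o^1,w^2)$ on writes by: (1) for distinct writes $w^3$ and $w^4$ with $w^4\in(\mathrm w,i,*,* )$: $(w^3,w^4)\in C_i^1$ iff $o^1\le_{A_i(\mathcal V)}w^4$ and $w^3\le_{A_i(\mathcal V)}w^2$. (2) For $k\ge2$ and distinct writes $w^3$ and $w^4$, with $w^4$ a write of process $i'$: $(w^3,w^4)\in C_i^k$ iff there are writes $w^5,w^6$ with $(w^5,w^6)\in C_i^{k-1}$, $w^3\le_{A_{i'}(\mathcal V)\sqcup C_i^{k-1}}w^5$ and $w^6\le_{A_{i'}(\mathcal V)}w^4$. $C_i(\mathcal V,o^1,w^2)=\bigcup_{k\ge1}C_i^k(\mathcal V,o^1,w^2)$. Relation $B_i$. For an operation $o^1$ and a write $w^2$ on the same variable, $(o^1,w^2)\in B_i(\mathcal V)$ iff $(o^1,w^2)\in DRO(V_i)$ and there is a process $m\in P$ such that either $m\ne i$ and $A_m(\mathcal V)\cup C_i(\mathcal V,o^1,w^2)$ has a directed cycle, or $m=i$ and $\bigl(A_i(\mathcal V)\setminus\{(o^1,w^2)\}\bigr)\cup C_i(\mathcal V,o^1,w^2)$ has a directed cycle. Records (RnR Model 2). A record of $\mathcal V$ is a family $\mathcal R=\{R_i\}_{i\in P}$ with $R_i\subseteq DRO(V_i)$. A set of views $\mathcal V'$ certifies a replay to be valid for $\mathcal R$ if $\mathcal V'$ explains a strongly causal consistent execution and $R_i\subseteq V'_i$ for all $i$. $\mathcal R$ is good if every such $\mathcal V'$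 has $DRO(V'_i)=DRO(V_i)$ for all $i\in P$. *)

theory Defs
  imports Main "HOL-Library.FuncSet"
begin

section \<open>Relations\<close>

definition strict_total_order :: "'a set \<Rightarrow> 'a rel \<Rightarrow> bool" where
  "strict_total_order S R \<longleftrightarrow> R \<subseteq> S \<times> S \<and> strict_linear_order_on S R"

definition respects_rel :: "'a rel \<Rightarrow> 'a rel \<Rightarrow> bool" where
  "respects_rel R Q \<longleftrightarrow> Q \<subseteq> R"

definition tjoin :: "'a rel \<Rightarrow> 'a rel \<Rightarrow> 'a rel"  (infixl "\<squnion>" 65) where
  "R \<squnion> Q = (R \<union> Q)\<^sup>+"

definition is_transitive_reduction :: "'a rel \<Rightarrow> 'a rel \<Rightarrow> bool" where
  "is_transitive_reduction Q R \<longleftrightarrow> Q\<^sup>+ = R\<^sup>+ \<and> (\<forall>Q'. Q' \<subset> Q \<longrightarrow> Q'\<^sup>+ \<noteq> R\<^sup>+)"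

text \<open>Only meaningful where the reduction is unique, e.g. for finite strict partial orders; see
  \<open>is_transitive_reduction_iff\<close> below.\<close>

definition transitive_reduction :: "'a rel \<Rightarrow> 'a rel" where
  "transitive_reduction R = (THE Q. is_transitive_reduction Q R)"

lemma trancl_covering:
  assumes "finite R" "trans R" "irrefl R"
  shows "{(a, b) \<in> R. \<not> (\<exists>c. (a, c) \<in> R \<and> (c, b) \<in> R)}\<^sup>+ = R" (is "?C\<^sup>+ = R")
proof
  show "?C\<^sup>+ \<subseteq> R"
    using trancl_mono_subset[of ?C R] trancl_id[OF assms(2)] by auto
  have fin: "finite {c. (a, c) \<in> R \<and> (c, b) \<in> R}" for a b
    by (rule finite_subset[OF _ finite_Range[OF assms(1)]]) blast
  have "(a, b) \<in> R \<Longrightarrow> (a, b) \<in> ?C\<^sup>+" for a b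
  proof (induction "card {c. (a, c) \<in> R \<and> (c, b) \<in> R}" arbitrary: a b rule: less_induct)
    case less
    show ?case
    proof (cases "\<exists>c. (a, c) \<in> R \<and> (c, b) \<in> R")
      case True
      then obtain c where c: "(a, c) \<in> R" "(c, b) \<in> R" by blast
      have irr: "(c, c) \<notin> R" using assms(3) by (auto simp: irrefl_def)
      have "{d. (a, d) \<in> R \<and> (d, c) \<in> R} \<subset> {d. (a, d) \<in> R \<and> (d, b) \<in> R}"
        using c irr transD[OF assms(2)] by blast
      then have 1: "(a, c) \<in> ?C\<^sup>+" using less.hyps[OF _ c(1)] psubset_card_mono[OF fin] by blast
      have "{d. (c, d) \<in> R \<and> (d, b) \<in> R} \<subset> {d. (a, d) \<in> R \<and> (d, b) \<in> R}"
        using c irr transD[OF assms(2)] by blast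
      then have 2: "(c, b) \<in> ?C\<^sup>+" using less.hyps[OF _ c(2)] psubset_card_mono[OF fin] by blast
      from 1 2 show ?thesis by (rule trancl_trans)
    next
      case False
      with less.prems show ?thesis by blast
    qed
  qed
  then show "R \<subseteq> ?C\<^sup>+" by auto
qed

lemma is_transitive_reduction_iff:
  assumes "finite R" "trans R" "irrefl R"
  shows "is_transitive_reduction Q R \<longleftrightarrow>
    Q = {(a, b) \<in> R. \<not> (\<exists>c. (a, c) \<in> R \<and> (c, b) \<in> R)}" (is "_ \<longleftrightarrow> Q = ?C")
proof -
  have R: "R\<^sup>+ = R" by (rule trancl_id[OF assms(2)])
  have C: "?C\<^sup>+ = R" by (rule trancl_covering[OF assms])
  have least: "?C \<subseteq> Q'" if "Q'\<^sup>+ = R" for Q'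
  proof clarify
    fix a b assume ab: "(a, b) \<in> R" "\<nexists>c. (a, c) \<in> R \<and> (c, b) \<in> R"
    then have "(a, b) \<in> Q'\<^sup>+" using that by simp
    then show "(a, b) \<in> Q'"
      by (cases rule: tranclE) (use ab that in auto)
  qed
  show ?thesis
  proof
    assume Q: "is_transitive_reduction Q R"
    then have "?C \<subseteq> Q" using least R by (simp add: is_transitive_reduction_def)
    moreover have "?C \<subset> Q \<Longrightarrow> ?C\<^sup>+ \<noteq> R\<^sup>+"
      using Q unfolding is_transitive_reduction_def by (elim conjE allE impE)
    then have "\<not> ?C \<subset> Q" using C R by argo
    ultimately show "Q = ?C" by (simp add: psubset_eq)
  next
    assume Q: "Q = ?C"
    have "Q'\<^sup>+ \<noteq> R\<^sup>+" if "Q' \<subset> Q" for Q'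
    proof
      assume "Q'\<^sup>+ = R\<^sup>+"
      then have "Q \<subseteq> Q'" using least[of Q'] R Q by argo
      with that show False by blast
    qed
    then show "is_transitive_reduction Q R"
      using C R Q unfolding is_transitive_reduction_def by blast
  qed
qed


section \<open>Systems\<close>

text \<open>\<open>written_value\<close> is only used on writes. \<open>prog_order\<close> is the program order of a single
  process.\<close>

record ('p, 'x, 'v, 'o) system =
  procs :: "'p set"
  variables :: "'x set"
  ops :: "'o set"
  is_write :: "'o \<Rightarrow> bool"
  proc_of :: "'o \<Rightarrow> 'p"
  var_of :: "'o \<Rightarrow> 'x"
  written_value :: "'o \<Rightarrow> 'v"
  default_value :: "'x \<Rightarrow> 'v"
  prog_order :: "'p \<Rightarrow> 'o rel"

definition writes :: "('p, 'x, 'v, 'o) system \<Rightarrow> 'o set" where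
  "writes S = {w \<in> ops S. is_write S w}"

definition reads :: "('p, 'x, 'v, 'o) system \<Rightarrow> 'o set" where
  "reads S = {r \<in> ops S. \<not> is_write S r}"

definition ops_of_proc :: "('p, 'x, 'v, 'o) system \<Rightarrow> 'p \<Rightarrow> 'o set" where
  "ops_of_proc S i = {a \<in> ops S. proc_of S a = i}"

definition ops_on_var :: "('p, 'x, 'v, 'o) system \<Rightarrow> 'x \<Rightarrow> 'o set" where
  "ops_on_var S x = {a \<in> ops S. var_of S a = x}"

definition view_dom :: "('p, 'x, 'v, 'o) system \<Rightarrow> 'p \<Rightarrow> 'o set" where
  "view_dom S i = ops_of_proc S i \<union> writes S"

definition PO :: "('p, 'x, 'v, 'o) system \<Rightarrow> 'o rel" where
  "PO S = (\<Union>i\<in>procs S. prog_order S i)"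

definition wf_system :: "('p, 'x, 'v, 'o) system \<Rightarrow> bool" where
  "wf_system S \<longleftrightarrow>
     finite (procs S) \<and> finite (variables S) \<and> finite (ops S) \<and>
     proc_of S ` ops S \<subseteq> procs S \<and> var_of S ` ops S \<subseteq> variables S \<and>
     (\<forall>i\<in>procs S. strict_total_order (ops_of_proc S i) (prog_order S i)) \<and>
     inj_on (written_value S) (writes S)"


section \<open>Executions and views\<close>

text \<open>An execution maps every read to the value it returns; it is \<^const>\<open>undefined\<close> on everything
  that is not a read, so that an execution is determined by the values of the reads.\<close>

definition executions :: "('p, 'x, 'v, 'o) system \<Rightarrow> ('o \<Rightarrow> 'v) set" where
  "executions S = (\<Pi>\<^sub>E r\<in>reads S.
     insert (default_value S (var_of S r))
       (written_value S ` {w \<in> writes S. var_of S w = var_of S r}))"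

definition preceding_writes :: "('p, 'x, 'v, 'o) system \<Rightarrow> 'o rel \<Rightarrow> 'o \<Rightarrow> 'o set" where
  "preceding_writes S V r = {w \<in> writes S. var_of S w = var_of S r \<and> (w, r) \<in> V}"

definition is_last_write :: "('p, 'x, 'v, 'o) system \<Rightarrow> 'o rel \<Rightarrow> 'o \<Rightarrow> 'o \<Rightarrow> bool" where
  "is_last_write S V r w \<longleftrightarrow>
     w \<in> preceding_writes S V r \<and> (\<forall>w'\<in>preceding_writes S V r. w' \<noteq> w \<longrightarrow> (w', w) \<in> V)"

definition is_view ::
  "('p, 'x, 'v, 'o) system \<Rightarrow> ('o \<Rightarrow> 'v) \<Rightarrow> 'p \<Rightarrow> 'o rel \<Rightarrow> bool" where
  "is_view S E i V \<longleftrightarrow>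
     strict_total_order (view_dom S i) V \<and>
     (\<forall>r\<in>reads S \<inter> view_dom S i.
        (preceding_writes S V r = {} \<longrightarrow> E r = default_value S (var_of S r)) \<and>
        (\<forall>w. is_last_write S V r w \<longrightarrow> E r = written_value S w))"

definition DRO :: "('p, 'x, 'v, 'o) system \<Rightarrow> 'o rel \<Rightarrow> 'o rel" where
  "DRO S V = (\<Union>x\<in>variables S. Restr V (ops_on_var S x))"


section \<open>Strong causal consistency\<close>

definition SCO :: "('p, 'x, 'v, 'o) system \<Rightarrow> ('p \<Rightarrow> 'o rel) \<Rightarrow> 'o rel" where
  "SCO S V = {(w1, w2). w1 \<in> writes S \<and> w2 \<in> writes S \<and> (w1, w2) \<in> V (proc_of S w2)}"

definition explains ::
  "('p, 'x, 'v, 'o) system \<Rightarrow> ('p \<Rightarrow> 'o rel) \<Rightarrow> ('o \<Rightarrow> 'v) \<Rightarrow> bool" where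
  "explains S V E \<longleftrightarrow> E \<in> executions S \<and>
     (\<forall>i\<in>procs S. is_view S E i (V i) \<and> respects_rel (V i) (SCO S V) \<and>
        respects_rel (V i) (Restr (PO S) (view_dom S i)))"

definition explains_strongly_causal ::
  "('p, 'x, 'v, 'o) system \<Rightarrow> ('p \<Rightarrow> 'o rel) \<Rightarrow> bool" where
  "explains_strongly_causal S V \<longleftrightarrow> (\<exists>E. explains S V E)"


section \<open>Strong write order\<close>

text \<open>Levels start at 1; level 0 is a dummy.\<close>

fun SWO_level ::
  "('p, 'x, 'v, 'o) system \<Rightarrow> ('p \<Rightarrow> 'o rel) \<Rightarrow> nat \<Rightarrow> 'o rel" where
  "SWO_level S V 0 = {}"
| "SWO_level S V (Suc 0) = {(w1, w2). w1 \<in> writes S \<and> w2 \<in> writes S \<and>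
     (let i = proc_of S w2 in
       (w1, w2) \<in> DRO S (V i) \<squnion> Restr (PO S) (view_dom S i))}"
| "SWO_level S V (Suc (Suc k)) = {(w1, w2). w1 \<in> writes S \<and> w2 \<in> writes S \<and>
     (let i = proc_of S w2 in
       (w1, w2) \<in> DRO S (V i) \<squnion> SWO_level S V (Suc k) \<squnion> Restr (PO S) (view_dom S i))}"

definition SWO :: "('p, 'x, 'v, 'o) system \<Rightarrow> ('p \<Rightarrow> 'o rel) \<Rightarrow> 'o rel" where
  "SWO S V = (\<Union>k\<in>{1..}. SWO_level S V k)"

definition SWO_foreign ::
  "('p, 'x, 'v, 'o) system \<Rightarrow> ('p \<Rightarrow> 'o rel) \<Rightarrow> 'p \<Rightarrow> 'o rel" where
  "SWO_foreign S V j = {(w1, w2) \<in> SWO S V. proc_of S w2 \<noteq> j}"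

definition A_rel :: "('p, 'x, 'v, 'o) system \<Rightarrow> ('p \<Rightarrow> 'o rel) \<Rightarrow> 'p \<Rightarrow> 'o rel" where
  "A_rel S V i = DRO S (V i) \<squnion> SWO_foreign S V i \<squnion> Restr (PO S) (view_dom S i)"


section \<open>The relations C and B\<close>

text \<open>Levels start at 1; level 0 is a dummy.\<close>

fun C_level ::
  "('p, 'x, 'v, 'o) system \<Rightarrow> ('p \<Rightarrow> 'o rel) \<Rightarrow> 'p \<Rightarrow> 'o \<Rightarrow> 'o \<Rightarrow> nat \<Rightarrow> 'o rel" where
  "C_level S V i o1 w2 0 = {}"
| "C_level S V i o1 w2 (Suc 0) = {(w3, w4). w3 \<in> writes S \<and> w4 \<in> writes S \<and> w3 \<noteq> w4 \<and>
     proc_of S w4 = i \<and> (o1, w4) \<in> (A_rel S V i)\<^sup>= \<and> (w3, w2) \<in> (A_rel S V i)\<^sup>=}"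
| "C_level S V i o1 w2 (Suc (Suc k)) =
     {(w3, w4). w3 \<in> writes S \<and> w4 \<in> writes S \<and> w3 \<noteq> w4 \<and>
       (let i' = proc_of S w4 in
         \<exists>w5\<in>writes S. \<exists>w6\<in>writes S. (w5, w6) \<in> C_level S V i o1 w2 (Suc k) \<and>
           (w3, w5) \<in> (A_rel S V i' \<squnion> C_level S V i o1 w2 (Suc k))\<^sup>= \<and>
           (w6, w4) \<in> (A_rel S V i')\<^sup>=)}"

definition C_rel ::
  "('p, 'x, 'v, 'o) system \<Rightarrow> ('p \<Rightarrow> 'o rel) \<Rightarrow> 'p \<Rightarrow> 'o \<Rightarrow> 'o \<Rightarrow> 'o rel" where
  "C_rel S V i o1 w2 = (\<Union>k\<in>{1..}. C_level S V i o1 w2 k)"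

definition B_rel :: "('p, 'x, 'v, 'o) system \<Rightarrow> ('p \<Rightarrow> 'o rel) \<Rightarrow> 'p \<Rightarrow> 'o rel" where
  "B_rel S V i = {(o1, w2). o1 \<in> ops S \<and> w2 \<in> writes S \<and> var_of S o1 = var_of S w2 \<and>
     (o1, w2) \<in> DRO S (V i) \<and>
     (\<exists>m\<in>procs S.
        m \<noteq> i \<and> \<not> acyclic (A_rel S V m \<union> C_rel S V i o1 w2) \<or>
        m = i \<and> \<not> acyclic ((A_rel S V i - {(o1, w2)}) \<union> C_rel S V i o1 w2))}"


section \<open>Records\<close>

definition is_record ::
  "('p, 'x, 'v, 'o) system \<Rightarrow> ('p \<Rightarrow> 'o rel) \<Rightarrow> ('p \<Rightarrow> 'o rel) \<Rightarrow> bool" where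
  "is_record S V R \<longleftrightarrow> (\<forall>i\<in>procs S. R i \<subseteq> DRO S (V i))"

definition certifies_replay ::
  "('p, 'x, 'v, 'o) system \<Rightarrow> ('p \<Rightarrow> 'o rel) \<Rightarrow> ('p \<Rightarrow> 'o rel) \<Rightarrow> bool" where
  "certifies_replay S R V' \<longleftrightarrow>
     explains_strongly_causal S V' \<and> (\<forall>i\<in>procs S. R i \<subseteq> V' i)"

definition good_record ::
  "('p, 'x, 'v, 'o) system \<Rightarrow> ('p \<Rightarrow> 'o rel) \<Rightarrow> ('p \<Rightarrow> 'o rel) \<Rightarrow> bool" where
  "good_record S V R \<longleftrightarrow> is_record S V R \<and>
     (\<forall>V'. certifies_replay S R V' \<longrightarrow> (\<forall>i\<in>procs S. DRO S (V' i) = DRO S (V i)))"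

end

theory Submission
  imports Defs
begin

text \<open>Consider a dropped \<open>B\<close> edge \<open>(o, t)\<close> of \<open>A\<^sub>i\<close> that is reversed in the replay. First, since \<open>B\<close>
  requires a \<open>C\<close> edge outside \<open>SWO\<close>, some write \<open>c\<close> of \<open>i\<close> satisfies \<open>o \<le> c\<close> and lies program-order
  before any given operation of \<open>i\<close> above \<open>t\<close>. Induction on the number of writes preceding \<open>b\<close> then
  shows that \<open>A\<^sub>i\<close> edges into operations \<open>b\<close> of \<open>i\<close> survive in the replay; in particular all of
  \<open>SWO\<close> does.

  If reversed edges remain, choose one, \<open>(p, q)\<close> at process \<open>i\<close>, such that the first write \<open>u\<close> of \<open>i\<close>
  above \<open>p\<close> is maximal in \<open>SWO\<close>, and then \<open>p\<close> maximal in \<open>A\<^sub>i\<close>. All targets of \<open>C\<close> edges for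
  \<open>(p, q)\<close> lie above \<open>u\<close>. A reversed edge obstructing the derivation of a \<open>C\<close> edge would have its
  source below the target of that \<open>C\<close> edge by maximality, so \<open>C\<close> is part of the strong causal order of
  the replay. By maximality again, the cycle that puts \<open>(p, q)\<close> into \<open>B\<close> avoids all reversed edges, or
  can be rerouted around \<open>p\<close>; it would then be a cycle in a replayed view.\<close>

section \<open>Auxiliary facts on relations\<close>

lemma tjoin_tjoin: "R \<squnion> Q \<squnion> P = (R \<union> Q \<union> P)\<^sup>+"
proof
  have "(R \<union> Q)\<^sup>+ \<union> P \<subseteq> (R \<union> Q \<union> P)\<^sup>+"
    using trancl_mono_subset[of "R \<union> Q" "R \<union> Q \<union> P"] by (auto intro: r_into_trancl')
  then show "R \<squnion> Q \<squnion> P \<subseteq> (R \<union> Q \<union> P)\<^sup>+"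
    unfolding tjoin_def by (metis trancl_mono_subset trancl_id trans_trancl)
  show "(R \<union> Q \<union> P)\<^sup>+ \<subseteq> R \<squnion> Q \<squnion> P"
    unfolding tjoin_def by (rule trancl_mono_subset) (auto intro: r_into_trancl')
qed

lemma transitive_reduction_eq:
  assumes "finite R" "trans R" "irrefl R"
  shows "transitive_reduction R = {(a, b) \<in> R. \<not> (\<exists>c. (a, c) \<in> R \<and> (c, b) \<in> R)}"
  unfolding transitive_reduction_def is_transitive_reduction_iff[OF assms] by simp

text \<open>The converse of a strict order is well-founded on a finite set. Used to choose extremal
  reversed edges and, for a converse order, first writes.\<close>

lemma finite_maximal_rel:
  assumes "finite Y" "trans r" "irrefl r" "y \<in> Y"
  obtains m where "m \<in> Y" "\<And>z. z \<in> Y \<Longrightarrow> (m, z) \<notin> r"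
proof -
  let ?r = "Restr r Y"
  have "trans ?r" by (rule trans_Restr[OF assms(2)])
  with assms(3) have "acyclic ?r"
    by (auto simp: acyclic_def irrefl_def trancl_id)
  moreover have "finite ?r" using assms(1) by blast
  ultimately have "wf (?r\<inverse>)" by (rule finite_acyclic_wf_converse[rotated])
  from wfE_min[OF this assms(4)] obtain m where m: "m \<in> Y"
    and min: "\<And>z. (z, m) \<in> ?r\<inverse> \<Longrightarrow> z \<notin> Y"
    by metis
  show thesis by (rule that[OF m]) (use min m in blast)
qed

section \<open>The orders \<open>SWO\<close>, \<open>A\<close> and \<open>B\<close>\<close>

text \<open>Isolates the order-theoretic content of \<open>explains\<close>, so that one locale
  serves the original and the replayed views.\<close>

locale causal_views =
  fixes S :: "('p, 'x, 'v, 'o) system" and V :: "'p \<Rightarrow> 'o rel"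
  assumes wf: "wf_system S"
    and view_total: "i \<in> procs S \<Longrightarrow> strict_total_order (view_dom S i) (V i)"
    and SCO_le: "i \<in> procs S \<Longrightarrow> SCO S V \<subseteq> V i"
    and PO_le: "i \<in> procs S \<Longrightarrow> Restr (PO S) (view_dom S i) \<subseteq> V i"
begin

lemma finite_ops: "finite (ops S)"
  using wf by (simp add: wf_system_def)

lemma proc_in: "a \<in> ops S \<Longrightarrow> proc_of S a \<in> procs S"
  using wf by (auto simp: wf_system_def)

lemma write_op: "w \<in> writes S \<Longrightarrow> w \<in> ops S"
  by (simp add: writes_def)

lemma write_proc: "w \<in> writes S \<Longrightarrow> proc_of S w \<in> procs S"
  by (simp add: proc_in write_op)

lemma view_dom_ops: "view_dom S i \<subseteq> ops S"
  by (auto simp: view_dom_def ops_of_proc_def writes_def)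

lemma own_in_view_dom: "a \<in> ops S \<Longrightarrow> a \<in> view_dom S (proc_of S a)"
  by (auto simp: view_dom_def ops_of_proc_def)

lemma view_dom:
  assumes "i \<in> procs S" "(a, b) \<in> V i"
  shows "a \<in> view_dom S i" "b \<in> view_dom S i"
  using view_total[OF assms(1)] assms(2) by (auto simp: strict_total_order_def)

lemma view_trans: "i \<in> procs S \<Longrightarrow> trans (V i)"
  using view_total[of i] by (simp add: strict_total_order_def strict_linear_order_on_def)

lemma view_irrefl: "i \<in> procs S \<Longrightarrow> (a, a) \<notin> V i"
  using view_total[of i]
  by (simp add: strict_total_order_def strict_linear_order_on_def irrefl_def)

lemma view_linear:
  assumes "i \<in> procs S" "a \<in> view_dom S i" "b \<in> view_dom S i" "a \<noteq> b"
  shows "(a, b) \<in> V i \<or> (b, a) \<in> V i"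
  using view_total[OF assms(1)] assms(2-)
  by (auto simp: strict_total_order_def strict_linear_order_on_def total_on_def)

lemma DRO_le: "DRO S W \<subseteq> W"
  by (auto simp: DRO_def)

lemma DRO_iff:
  assumes "i \<in> procs S"
  shows "(a, b) \<in> DRO S (V i) \<longleftrightarrow> (a, b) \<in> V i \<and> var_of S a = var_of S b"
proof -
  have "a \<in> ops S \<and> var_of S a \<in> variables S" if "(a, b) \<in> V i"
    using that view_dom[OF assms that] view_dom_ops[of i] wf by (auto simp: wf_system_def)
  moreover have "b \<in> ops S" if "(a, b) \<in> V i"
    using view_dom[OF assms that] view_dom_ops[of i] by blast
  ultimately show ?thesis by (auto simp: DRO_def ops_on_var_def)
qed

lemma own_linear:
  assumes "a \<in> ops S" "b \<in> ops S" "proc_of S a = i" "proc_of S b = i" "a \<noteq> b"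
  shows "(a, b) \<in> PO S \<or> (b, a) \<in> PO S"
proof -
  have i: "i \<in> procs S" using assms proc_in by auto
  then have "strict_total_order (ops_of_proc S i) (prog_order S i)"
    using wf by (simp add: wf_system_def)
  moreover have "a \<in> ops_of_proc S i" "b \<in> ops_of_proc S i"
    using assms by (auto simp: ops_of_proc_def)
  ultimately have "(a, b) \<in> prog_order S i \<or> (b, a) \<in> prog_order S i"
    using assms(5) by (auto simp: strict_total_order_def strict_linear_order_on_def total_on_def)
  then show ?thesis using i by (auto simp: PO_def)
qed

section \<open>The order \<open>A i\<close> and the fixed point property of
  \<open>SWO\<close>\<close>

abbreviation "A \<equiv> A_rel S V"

lemma A_eq: "A i = (DRO S (V i) \<union> SWO_foreign S V i \<union> Restr (PO S) (view_dom S i))\<^sup>+"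
  unfolding A_rel_def tjoin_tjoin ..

lemma A_trans: "trans (A i)"
  unfolding A_eq by (rule trans_trancl)

lemma A_DRO: "DRO S (V i) \<subseteq> A i"
  unfolding A_eq by (intro subsetI r_into_trancl') blast

lemma A_SWO_foreign: "SWO_foreign S V i \<subseteq> A i"
  unfolding A_eq by (intro subsetI r_into_trancl') blast

lemma A_PO: "Restr (PO S) (view_dom S i) \<subseteq> A i"
  unfolding A_eq by (intro subsetI r_into_trancl') blast

text \<open>By induction, all generators of a level lie in the transitive view of the process
  performing the target write, hence so does their closure.\<close>

lemma SWO_level_subset_SCO: "SWO_level S V k \<subseteq> SCO S V"
proof (induction k)
  case 0
  then show ?case by simp
next
  case (Suc k)
  have *: "(a, b) \<in> SCO S V" if "a \<in> writes S" "b \<in> writes S" and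
    ab: "(a, b) \<in> (DRO S (V (proc_of S b)) \<union> Q \<union>
      Restr (PO S) (view_dom S (proc_of S b)))\<^sup>+" (is "_ \<in> ?X\<^sup>+")
    and Q: "Q \<subseteq> SCO S V" for a b Q
  proof -
    have i: "proc_of S b \<in> procs S" by (simp add: write_proc that)
    have "?X \<subseteq> V (proc_of S b)" using DRO_le Q SCO_le[OF i] PO_le[OF i] by blast
    then have "?X\<^sup>+ \<subseteq> V (proc_of S b)"
      by (metis trancl_mono_subset trancl_id view_trans[OF i])
    then show ?thesis using ab that by (auto simp: SCO_def)
  qed
  show ?case
  proof (cases k)
    case 0
    then show ?thesis using *[of _ _ "{}"] by (auto simp: tjoin_def Let_def)
  next
    case (Suc j)
    then show ?thesis using *[of _ _ "SWO_level S V k"] \<open>SWO_level S V k \<subseteq> SCO S V\<close>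
      by (auto simp: tjoin_tjoin Let_def)
  qed
qed

lemma SWO_level_mono_Suc: "SWO_level S V k \<subseteq> SWO_level S V (Suc k)"
proof (induction k rule: induct_nat_012)
  case 0
  then show ?case by simp
next
  case 1
  have "DRO S (V i) \<squnion> P \<subseteq> DRO S (V i) \<squnion> Q \<squnion> P" for i P Q
    unfolding tjoin_tjoin by (unfold tjoin_def, rule trancl_mono_subset) blast
  then show ?case by (fastforce simp: Let_def)
next
  case (ge2 k)
  have "DRO S (V i) \<squnion> SWO_level S V (Suc k) \<squnion> P
      \<subseteq> DRO S (V i) \<squnion> SWO_level S V (Suc (Suc k)) \<squnion> P" for i P
    unfolding tjoin_tjoin by (rule trancl_mono_subset) (use ge2 in blast)
  then show ?case by (auto simp only: SWO_level.simps Let_def)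
qed

lemma SWO_level_mono: "j \<le> k \<Longrightarrow> SWO_level S V j \<subseteq> SWO_level S V k"
  by (rule lift_Suc_mono_le[of "SWO_level S V"]) (rule SWO_level_mono_Suc)

lemma SWO_eq: "SWO S V = (\<Union>k. SWO_level S V k)"
proof -
  have "SWO_level S V k \<subseteq> SWO_level S V (Suc k)" for k by (rule SWO_level_mono_Suc)
  then show ?thesis unfolding SWO_def by fastforce
qed

lemma A_subset_view:
  assumes "i \<in> procs S"
  shows "A i \<subseteq> V i"
proof -
  have "SWO_foreign S V i \<subseteq> SCO S V"
    using SWO_level_subset_SCO by (auto simp: SWO_foreign_def SWO_eq)
  then have "DRO S (V i) \<union> SWO_foreign S V i \<union> Restr (PO S) (view_dom S i) \<subseteq> V i"
    using DRO_le SCO_le[OF assms] PO_le[OF assms] by blast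
  then show ?thesis
    unfolding A_eq by (metis trancl_mono_subset trancl_id view_trans[OF assms])
qed

lemma A_irrefl: "i \<in> procs S \<Longrightarrow> (a, a) \<notin> A i"
  using A_subset_view view_irrefl by blast

lemma A_view_dom:
  assumes "i \<in> procs S" "(a, b) \<in> A i"
  shows "a \<in> view_dom S i" "b \<in> view_dom S i"
  using view_dom[OF assms(1)] A_subset_view[OF assms(1)] assms(2) by blast+

lemma A_acyclic: "i \<in> procs S \<Longrightarrow> acyclic (A i)"
  by (simp add: acyclic_def A_trans trancl_id A_irrefl)

lemma SWO_writes: "(a, b) \<in> SWO S V \<Longrightarrow> a \<in> writes S \<and> b \<in> writes S"
  using SWO_level_subset_SCO by (fastforce simp: SWO_eq SCO_def)

text \<open>Only the foreign part of \<open>SWO\<close> generates \<open>A i\<close>. Edges into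
  writes of \<open>i\<close> are recovered from \<open>DRO\<close>, program order and lower
  levels.\<close>

lemma SWO_level_subset_A:
  assumes "i \<in> procs S"
  shows "SWO_level S V k \<subseteq> A i"
proof (induction k)
  case 0
  then show ?case by simp
next
  case (Suc k)
  have own: "(a, b) \<in> A i" if "(a, b) \<in> (DRO S (V i) \<union> Q \<union> Restr (PO S) (view_dom S i))\<^sup>+"
    (is "_ \<in> ?X\<^sup>+") and Q: "Q \<subseteq> A i" for a b Q
  proof -
    have "?X \<subseteq> A i" using A_DRO Q A_PO by blast
    then have "?X\<^sup>+ \<subseteq> A i" by (metis trancl_mono_subset trancl_id A_trans)
    then show ?thesis using that by blast
  qed
  have "(a, b) \<in> A i" if ab: "(a, b) \<in> SWO_level S V (Suc k)" for a b
  proof (cases "proc_of S b = i")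
    case True
    show ?thesis
    proof (cases k)
      case 0
      then show ?thesis using own[of a b "{}"] ab True by (auto simp: tjoin_def Let_def)
    next
      case (Suc j)
      then show ?thesis using own[of a b "SWO_level S V k"] ab True Suc.IH
        by (auto simp: tjoin_tjoin Let_def)
    qed
  next
    case False
    then show ?thesis using ab A_SWO_foreign by (auto simp: SWO_foreign_def SWO_eq)
  qed
  then show ?case by auto
qed

lemma SWO_subset_A: "i \<in> procs S \<Longrightarrow> SWO S V \<subseteq> A i"
  using SWO_level_subset_A by (auto simp: SWO_eq)

text \<open>A path has finitely many edges and the levels increase, so one level covers all its
  \<open>SWO\<close> edges.\<close>

lemma A_finite_level:
  assumes "(a, b) \<in> A i"
  shows "\<exists>k. (a, b) \<in> (DRO S (V i) \<union> SWO_level S V k \<union> Restr (PO S) (view_dom S i))\<^sup>+"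
proof -
  let ?X = "\<lambda>k. DRO S (V i) \<union> SWO_level S V k \<union> Restr (PO S) (view_dom S i)"
  have edge: "\<exists>k. (x, y) \<in> ?X k"
    if "(x, y) \<in> DRO S (V i) \<union> SWO_foreign S V i \<union> Restr (PO S) (view_dom S i)" for x y
    using that by (auto simp: SWO_foreign_def SWO_eq)
  have mono: "(?X j)\<^sup>+ \<subseteq> (?X k)\<^sup>+" if "j \<le> k" for j k
    by (rule trancl_mono_subset) (use SWO_level_mono[OF that] in blast)
  show ?thesis
    using assms unfolding A_eq
  proof (induction rule: trancl_induct)
    case (base y)
    then show ?case using edge[of a y] by blast
  next
    case (step y z)
    then obtain j where j: "(a, y) \<in> (?X j)\<^sup>+" by blast
    from edge[OF step(2)] obtain k where k: "(y, z) \<in> ?X k" by blast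
    have "(a, y) \<in> (?X (max j k))\<^sup>+" "(y, z) \<in> (?X (max j k))\<^sup>+"
      using mono[of j "max j k"] mono[of k "max j k"] j k by auto
    then show ?case by (blast intro: trancl_trans)
  qed
qed

lemma SWO_iff:
  "(a, b) \<in> SWO S V \<longleftrightarrow> a \<in> writes S \<and> b \<in> writes S \<and> (a, b) \<in> A (proc_of S b)"
proof
  assume ab: "a \<in> writes S \<and> b \<in> writes S \<and> (a, b) \<in> A (proc_of S b)"
  then obtain k where k: "(a, b) \<in> (DRO S (V (proc_of S b)) \<union> SWO_level S V k \<union>
      Restr (PO S) (view_dom S (proc_of S b)))\<^sup>+" (is "_ \<in> (?X k)\<^sup>+")
    using A_finite_level by blast
  \<comment> \<open>Level \<open>k\<close> may be the dummy level 0, so it is raised to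
    \<open>Suc k\<close> before the recursive clause applies.\<close>
  have "(?X k)\<^sup>+ \<subseteq> (?X (Suc k))\<^sup>+"
    by (rule trancl_mono_subset) (use SWO_level_mono_Suc[of k] in blast)
  then have "(a, b) \<in> SWO_level S V (Suc (Suc k))"
    using ab k by (auto simp only: SWO_level.simps Let_def tjoin_tjoin)
  then show "(a, b) \<in> SWO S V" unfolding SWO_eq by blast
qed (use SWO_writes SWO_subset_A write_proc in blast)

lemma SWO_trans: "trans (SWO S V)"
  by (rule transI) (meson SWO_iff SWO_subset_A write_proc A_trans transD subsetD)

lemma own_A_linear:
  assumes "a \<in> ops S" "b \<in> ops S" "proc_of S a = i" "proc_of S b = i"
  shows "(a, b) \<in> (A i)\<^sup>= \<or> (b, a) \<in> PO S \<inter> A i"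
proof -
  have "a \<in> view_dom S i" "b \<in> view_dom S i"
    using assms own_in_view_dom[of a] own_in_view_dom[of b] by auto
  then show ?thesis using own_linear[OF assms] A_PO[of i] by auto
qed

section \<open>Own writes forced by membership in \<open>B\<close>\<close>

text \<open>If the base level stays inside \<open>SWO\<close>, so do all levels by
  \<open>SWO_iff\<close>. The graphs in the definition of \<open>B\<close> would then be subgraphs
  of the acyclic \<open>A m\<close>.\<close>

lemma B_rel_base:
  assumes "i \<in> procs S" "(o1, w2) \<in> B_rel S V i"
  shows "\<not> C_level S V i o1 w2 (Suc 0) \<subseteq> SWO S V"
proof
  assume base: "C_level S V i o1 w2 (Suc 0) \<subseteq> SWO S V"
  have "C_level S V i o1 w2 k \<subseteq> SWO S V" for k
  proof (induction k rule: induct_nat_012)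
    case 0
    then show ?case by simp
  next
    case 1
    then show ?case by (rule base)
  next
    case (ge2 k)
    have "(w3, w4) \<in> SWO S V"
      if mem: "(w3, w4) \<in> C_level S V i o1 w2 (Suc (Suc k))" for w3 w4
    proof -
      let ?n = "proc_of S w4"
      from mem have w: "w3 \<in> writes S" "w4 \<in> writes S" "w3 \<noteq> w4" by auto
      have n: "?n \<in> procs S" by (rule write_proc[OF w(2)])
      from mem obtain w5 w6 where
        "(w5, w6) \<in> C_level S V i o1 w2 (Suc k)"
        "(w3, w5) \<in> (A ?n \<squnion> C_level S V i o1 w2 (Suc k))\<^sup>="
        "(w6, w4) \<in> (A ?n)\<^sup>=" by (auto simp: Let_def)
      moreover have C: "C_level S V i o1 w2 (Suc k) \<subseteq> A ?n"
        using ge2 SWO_subset_A[OF n] by blast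
      then have "A ?n \<squnion> C_level S V i o1 w2 (Suc k) = A ?n"
        by (simp add: tjoin_def Un_absorb2 trancl_id A_trans)
      ultimately have "(w3, w4) \<in> A ?n"
        using C A_trans[of ?n] by (auto dest: transD)
      then show ?thesis using w by (simp add: SWO_iff)
    qed
    then show ?case by auto
  qed
  then have C: "C_rel S V i o1 w2 \<subseteq> SWO S V" by (auto simp: C_rel_def)
  have "acyclic (A m \<union> C_rel S V i o1 w2)" if "m \<in> procs S" for m
  proof -
    have "A m \<union> C_rel S V i o1 w2 = A m" using C SWO_subset_A[OF that] by blast
    then show ?thesis using A_acyclic[OF that] by simp
  qed
  moreover have "acyclic (A i - {(o1, w2)} \<union> C_rel S V i o1 w2)"
    by (rule acyclic_subset[OF A_acyclic[OF assms(1)]])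
      (use C SWO_subset_A[OF assms(1)] in blast)
  ultimately show False using assms by (auto simp: B_rel_def)
qed

text \<open>Otherwise every own write \<open>w4\<close> above \<open>o1\<close> is at or after
  \<open>b\<close>. Each base edge then satisfies w3 <= w2 <= b <= w4 in \<open>A i\<close> and lies
  in \<open>SWO\<close>, against \<open>B_rel_base\<close>.\<close>

lemma B_rel_own_write_before:
  assumes i: "i \<in> procs S" and B: "(o1, w2) \<in> B_rel S V i"
    and b: "b \<in> ops S" "proc_of S b = i" "(w2, b) \<in> (A i)\<^sup>="
  shows "\<exists>c\<in>writes S. proc_of S c = i \<and> (o1, c) \<in> (A i)\<^sup>= \<and> (c, b) \<in> PO S \<inter> A i"
proof (rule ccontr)
  assume none: "\<not> ?thesis"
  have "(w3, w4) \<in> SWO S V" if "(w3, w4) \<in> C_level S V i o1 w2 (Suc 0)" for w3 w4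
  proof -
    from that have w: "w3 \<in> writes S" "w4 \<in> writes S" "w3 \<noteq> w4" "proc_of S w4 = i"
      "(o1, w4) \<in> (A i)\<^sup>=" "(w3, w2) \<in> (A i)\<^sup>=" by auto
    then have "(b, w4) \<in> (A i)\<^sup>="
      using none own_A_linear[of b w4 i] b write_op by blast
    then have "(w3, w4) \<in> A i"
      using w b(3) A_trans[of i] by (auto dest: transD)
    then show ?thesis using w by (simp add: SWO_iff)
  qed
  then show False using B_rel_base[OF i B] by auto
qed

lemma B_rel_own_write:
  assumes "i \<in> procs S" "(o1, w2) \<in> B_rel S V i"
  shows "\<exists>c\<in>writes S. proc_of S c = i \<and> (o1, c) \<in> (A i)\<^sup>="
  using B_rel_base[OF assms] by auto

section \<open>Covering edges of \<open>A i\<close>\<close>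

abbreviation "A_red i \<equiv> transitive_reduction (A i)"

lemma finite_A:
  assumes "i \<in> procs S"
  shows "finite (A i)"
proof (rule finite_subset)
  show "A i \<subseteq> ops S \<times> ops S" using A_view_dom[OF assms] view_dom_ops[of i] by auto
qed (simp add: finite_ops)

lemma A_red_eq:
  assumes "i \<in> procs S"
  shows "A_red i = {(a, b) \<in> A i. \<not> (\<exists>c. (a, c) \<in> A i \<and> (c, b) \<in> A i)}"
  by (rule transitive_reduction_eq)
    (simp_all add: assms finite_A A_trans A_irrefl irrefl_def)

lemma A_red_trancl: "i \<in> procs S \<Longrightarrow> (A_red i)\<^sup>+ = A i"
  unfolding A_red_eq by (rule trancl_covering) (simp_all add: finite_A A_trans A_irrefl irrefl_def)

text \<open>A path of two or more generators would factor the covering edge.\<close>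

lemma A_red_subset:
  assumes "i \<in> procs S"
  shows "A_red i \<subseteq> DRO S (V i) \<union> SWO_foreign S V i \<union> Restr (PO S) (view_dom S i)" (is "_ \<subseteq> ?X")
proof (rule subrelI)
  fix a b assume ab: "(a, b) \<in> A_red i"
  have "(a, b) \<in> ?X\<^sup>+" using ab unfolding A_red_eq[OF assms] by (auto simp: A_eq)
  then show "(a, b) \<in> ?X"
  proof (cases rule: tranclE)
    case (step c)
    then have "(a, c) \<in> A i" "(c, b) \<in> A i" unfolding A_eq by blast+
    then show ?thesis using ab unfolding A_red_eq[OF assms] by blast
  qed
qed

section \<open>Induction measure and first writes\<close>

text \<open>Counting in the view of the process of \<open>b\<close> itself makes the measure
  decrease from \<open>b\<close> to any write before it, even one of another process.\<close>

definition writes_before :: "'o \<Rightarrow> nat" where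
  "writes_before b = card {w \<in> writes S. (w, b) \<in> V (proc_of S b)}"

text \<open>Strong causality carries the writes before \<open>c\<close> into \<open>V i\<close>,
  where transitivity puts them before \<open>b\<close>; \<open>c\<close> itself is counted only for
  \<open>b\<close>.\<close>

lemma writes_before_less:
  assumes i: "i \<in> procs S" and c: "c \<in> writes S" and b: "proc_of S b = i" "(c, b) \<in> V i"
  shows "writes_before c < writes_before b"
  unfolding writes_before_def
proof (rule psubset_card_mono)
  show "finite {w \<in> writes S. (w, b) \<in> V (proc_of S b)}"
    by (rule finite_subset[OF _ finite_ops]) (auto simp: writes_def)
  have "(w, b) \<in> V i" if "w \<in> writes S" "(w, c) \<in> V (proc_of S c)" for w
  proof -
    have "(w, c) \<in> SCO S V" using that c by (simp add: SCO_def)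
    then have "(w, c) \<in> V i" using SCO_le[OF i] by blast
    then show ?thesis using b(2) view_trans[OF i] by (blast dest: transD)
  qed
  moreover have "(c, c) \<notin> V (proc_of S c)" using view_irrefl write_proc[OF c] by blast
  ultimately show "{w \<in> writes S. (w, c) \<in> V (proc_of S c)}
      \<subset> {w \<in> writes S. (w, b) \<in> V (proc_of S b)}"
    using b c by blast
qed


lemma A_le_trans: "\<lbrakk>(a, b) \<in> (A i)\<^sup>=; (b, c) \<in> (A i)\<^sup>=\<rbrakk> \<Longrightarrow> (a, c) \<in> (A i)\<^sup>="
  using A_trans[of i] by (auto dest: transD)

text \<open>Attaches a write of the same process to the source of a reversed edge, so that reversed
  edges of different processes can be compared in \<open>SWO\<close>.\<close>

definition first_write :: "'p \<Rightarrow> 'o \<Rightarrow> 'o \<Rightarrow> bool" where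
  "first_write n a u \<longleftrightarrow> u \<in> writes S \<and> proc_of S u = n \<and> (a, u) \<in> (A n)\<^sup>= \<and>
    (\<forall>c\<in>writes S. proc_of S c = n \<longrightarrow> (a, c) \<in> (A n)\<^sup>= \<longrightarrow> (u, c) \<in> (A n)\<^sup>=)"

lemma first_write_exists:
  assumes n: "n \<in> procs S" and c: "c \<in> writes S" "proc_of S c = n" "(a, c) \<in> (A n)\<^sup>="
  shows "\<exists>u. first_write n a u"
proof -
  let ?U = "{c \<in> writes S. proc_of S c = n \<and> (a, c) \<in> (A n)\<^sup>=}"
  have "finite ?U" by (rule finite_subset[OF _ finite_ops]) (auto simp: writes_def)
  moreover have "trans ((A n)\<inverse>)" "irrefl ((A n)\<inverse>)"
    by (simp_all add: A_trans A_irrefl[OF n] irrefl_def)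
  moreover have "c \<in> ?U" using c by blast
  ultimately obtain u where u: "u \<in> ?U" "\<And>z. z \<in> ?U \<Longrightarrow> (u, z) \<notin> (A n)\<inverse>"
    by (rule finite_maximal_rel) (rule that)
  have "(u, d) \<in> (A n)\<^sup>=" if "d \<in> ?U" for d
    using own_A_linear[of u d n] u that write_op by auto
  then show ?thesis using u(1) by (auto simp: first_write_def)
qed

end

section \<open>Edges preserved by replays\<close>

text \<open>\<open>V\<close> holds the original views and \<open>T\<close> the replayed
  ones.\<close>

locale replay = causal_views S V + T: causal_views S T
  for S :: "('p, 'x, 'v, 'o) system" and V T :: "'p \<Rightarrow> 'o rel" +
  assumes recorded: "i \<in> procs S \<Longrightarrow>
    transitive_reduction (A_rel S V i) - (SWO_foreign S V i \<union> PO S \<union> B_rel S V i) \<subseteq> T i"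
begin

lemma T_less_le_trans:
  assumes "i \<in> procs S" "(a, b) \<in> T i" "(b, c) \<in> (T i)\<^sup>="
  shows "(a, c) \<in> T i"
  using T.view_trans[OF assms(1)] assms(2,3) by (auto dest: transD)

lemma T_le_less_trans:
  assumes "i \<in> procs S" "(a, b) \<in> (T i)\<^sup>=" "(b, c) \<in> T i"
  shows "(a, c) \<in> T i"
  using T.view_trans[OF assms(1)] assms(2,3) by (auto dest: transD)

lemma T_own_target:
  assumes "a \<in> writes S" "b \<in> writes S" "(a, b) \<in> T (proc_of S b)" "m \<in> procs S"
  shows "(a, b) \<in> T m"
  using T.SCO_le[OF assms(4)] assms(1-3) by (auto simp: SCO_def)

text \<open>A dropped edge into an operation of the process itself can be bypassed, since
  its membership in \<open>B\<close> provides an own write \<open>c\<close> that lies program-order before the target.\<close>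

lemma A_own_target:
  assumes "b \<in> ops S" "(a, b) \<in> A (proc_of S b)"
  shows "(a, b) \<in> T (proc_of S b)"
  using assms
proof (induction "writes_before b" arbitrary: a b rule: less_induct)
  case less
  define k where "k = proc_of S b"
  have k: "k \<in> procs S" using less.prems proc_in by (simp add: k_def)
  have "(a, b) \<in> (A_red k)\<^sup>+" using less.prems k by (simp add: A_red_trancl k_def)
  then show ?case
    unfolding k_def[symmetric]
  proof (induction rule: converse_trancl_induct)
    \<comment> \<open>Prepends a covering edge to a path into \<open>b\<close> whose remainder
      already survives.\<close>
    have edge: "(a, b) \<in> T k"
      if ac: "(a, c) \<in> A_red k" and cb: "(c, b) \<in> (A k)\<^sup>=" "(c, b) \<in> (T k)\<^sup>=" for a c
    proof (cases "(a, c) \<in> T k")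
      case True
      then show ?thesis using T_less_le_trans[OF k] cb by blast
    next
      case False
      have "(a, c) \<in> A k" using ac by (simp add: A_red_eq[OF k])
      then have dom: "a \<in> view_dom S k" "c \<in> view_dom S k" using A_view_dom[OF k] by auto
      then have "(a, c) \<notin> PO S" using False T.PO_le[OF k] by blast
      then consider "(a, c) \<in> SWO_foreign S V k" | "(a, c) \<in> B_rel S V k"
        using recorded[OF k] ac False by blast
      then show ?thesis
      proof cases
        case 1
        \<comment> \<open>Being of another process, \<open>c\<close> differs from \<open>b\<close>,
          so the outer induction applies to it; strong causality of the replay then brings the edge
          into \<open>T k\<close>.\<close>
        then have c: "a \<in> writes S" "c \<in> writes S" "proc_of S c \<noteq> k"
            "(a, c) \<in> A (proc_of S c)"
          by (auto simp: SWO_foreign_def SWO_iff)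
        then have "(c, b) \<in> A k" using cb k_def by auto
        then have "writes_before c < writes_before b"
          using writes_before_less[OF k c(2) k_def[symmetric]] A_subset_view[OF k] by blast
        then have "(a, c) \<in> T (proc_of S c)" by (rule less.hyps[OF _ write_op[OF c(2)] c(4)])
        with False T_own_target[OF c(1,2) _ k] show ?thesis by blast
      next
        case 2
        obtain c' where c': "c' \<in> writes S" "proc_of S c' = k" "(a, c') \<in> (A k)\<^sup>="
            "(c', b) \<in> PO S \<inter> A k"
          using B_rel_own_write_before[OF k 2 less.prems(1) k_def[symmetric] cb(1)] by blast
        then have "writes_before c' < writes_before b"
          using writes_before_less[OF k c'(1) k_def[symmetric]] A_subset_view[OF k] by blast
        from less.hyps[OF this write_op[OF c'(1)], of a]
        have "(a, c') \<in> (T k)\<^sup>=" using c'(2,3) by auto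
        moreover have "(c', b) \<in> T k"
          using c'(4) T.PO_le[OF k] A_view_dom[OF k, of c' b] by blast
        ultimately show ?thesis by (rule T_le_less_trans[OF k])
      qed
    qed
    show "(y, b) \<in> T k" if "(y, b) \<in> A_red k" for y
      using edge[OF that] by blast
    show "(y, b) \<in> T k" if "(y, z) \<in> A_red k" "(z, b) \<in> (A_red k)\<^sup>+" "(z, b) \<in> T k" for y z
      using edge[OF that(1)] that k by (simp add: A_red_trancl)
  qed
qed

lemma A_le_own_target:
  assumes "b \<in> ops S" "proc_of S b = n" "(a, b) \<in> (A n)\<^sup>="
  shows "(a, b) \<in> (T n)\<^sup>="
  using A_own_target[of b a] assms by auto

lemma SWO_subset_T:
  assumes "m \<in> procs S"
  shows "SWO S V \<subseteq> T m"
proof (rule subrelI)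
  fix a b assume "(a, b) \<in> SWO S V"
  then have "a \<in> writes S" "b \<in> writes S" "(a, b) \<in> T (proc_of S b)"
    using A_own_target write_op by (auto simp: SWO_iff)
  then show "(a, b) \<in> T m" using assms by (rule T_own_target)
qed

section \<open>Reversed covering edges\<close>

text \<open>Covering edges suffice: if all of them survive, so does their closure
  \<open>A n\<close>.\<close>

definition flips :: "('p \<times> 'o \<times> 'o) set" where
  "flips = {(n, a, b). n \<in> procs S \<and> (a, b) \<in> A_red n \<and> (a, b) \<notin> T n}"

text \<open>\<open>SWO\<close>, program order and recorded edges survive, so only a \<open>B\<close>
  edge can fail; totality of \<open>T n\<close> then reverses it.\<close>

lemma flipsD:
  assumes "(n, a, b) \<in> flips"
  shows "n \<in> procs S" "(a, b) \<in> A n" "(a, b) \<in> B_rel S V n" "(b, a) \<in> T n"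
proof -
  have n: "n \<in> procs S" and red: "(a, b) \<in> A_red n" and nT: "(a, b) \<notin> T n"
    using assms by (auto simp: flips_def)
  show "n \<in> procs S" by (rule n)
  show ab: "(a, b) \<in> A n" using red by (simp add: A_red_eq[OF n])
  then have dom: "a \<in> view_dom S n" "b \<in> view_dom S n" using A_view_dom[OF n] by auto
  have "(a, b) \<notin> PO S" using dom nT T.PO_le[OF n] by blast
  moreover have "(a, b) \<notin> SWO_foreign S V n"
    using SWO_subset_T[OF n] nT by (auto simp: SWO_foreign_def)
  ultimately show "(a, b) \<in> B_rel S V n" using recorded[OF n] red nT by blast
  have "a \<noteq> b" using ab A_irrefl[OF n] by blast
  then show "(b, a) \<in> T n" using T.view_linear[OF n] dom nT by blast
qed

lemma flip_first_write:
  assumes "(n, a, b) \<in> flips"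
  obtains v where "first_write n a v"
  using first_write_exists[OF flipsD(1)[OF assms]]
    B_rel_own_write[OF flipsD(1)[OF assms] flipsD(3)[OF assms]] by blast

text \<open>Both targets are on the variable of \<open>a\<close>, so \<open>DRO\<close> compares
  them and one of the two edges factors through the other target.\<close>

lemma flips_unique_target:
  assumes "(n, a, b) \<in> flips" "(n, a, b') \<in> flips"
  shows "b = b'"
proof (rule ccontr)
  assume ne: "b \<noteq> b'"
  have n: "n \<in> procs S" using flipsD assms by blast
  have "(a, b) \<in> DRO S (V n)" "(a, b') \<in> DRO S (V n)"
    using flipsD(3)[OF assms(1)] flipsD(3)[OF assms(2)] by (auto simp: B_rel_def)
  then have "(a, b) \<in> V n" "(a, b') \<in> V n" "var_of S b = var_of S b'"
    by (auto simp: DRO_iff[OF n])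
  then have "(b, b') \<in> DRO S (V n) \<or> (b', b) \<in> DRO S (V n)"
    using view_linear[OF n] view_dom[OF n] ne by (auto simp: DRO_iff[OF n])
  then have "(b, b') \<in> A n \<or> (b', b) \<in> A n" using A_DRO by blast
  moreover have "(a, b) \<in> A_red n" "(a, b') \<in> A_red n" using assms by (auto simp: flips_def)
  ultimately show False by (auto simp: A_red_eq[OF n])
qed

text \<open>After refining to covering edges, the path is followed inside \<open>T n\<close> up to
  its first reversed edge.\<close>

lemma path_or_flip:
  assumes n: "n \<in> procs S" and X: "X \<subseteq> T n" and ab: "(a, b) \<in> (A n \<union> X)\<^sup>+"
  shows "(a, b) \<in> T n \<or>
    (\<exists>a' b'. (n, a', b') \<in> flips \<and> (a, a') \<in> (T n)\<^sup>= \<and> (a, a') \<in> (A n \<union> X)\<^sup>*)"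
proof -
  have red: "(A n \<union> X)\<^sup>+ = (A_red n \<union> X)\<^sup>+"
  proof
    have "A n \<union> X \<subseteq> (A_red n \<union> X)\<^sup>+"
      using trancl_mono_subset[of "A_red n" "A_red n \<union> X"] A_red_trancl[OF n]
      by (auto intro: r_into_trancl')
    then show "(A n \<union> X)\<^sup>+ \<subseteq> (A_red n \<union> X)\<^sup>+"
      by (metis trancl_mono_subset trancl_id trans_trancl)
    show "(A_red n \<union> X)\<^sup>+ \<subseteq> (A n \<union> X)\<^sup>+"
      by (rule trancl_mono_subset) (auto simp: A_red_eq[OF n])
  qed
  have edge: "(y, z) \<in> T n \<or> (n, y, z) \<in> flips" if "(y, z) \<in> A_red n \<union> X" for y z
    using that X n by (auto simp: flips_def)
  have "(a, b) \<in> (A_red n \<union> X)\<^sup>+" using ab red by simp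
  then show ?thesis
  proof (induction rule: trancl_induct)
    case (base y)
    then show ?case using edge by blast
  next
    case (step y z)
    have "(a, y) \<in> (A n \<union> X)\<^sup>*" using step(1) red by (simp add: trancl_into_rtrancl)
    then show ?case using step.IH edge[OF step(2)] T_less_le_trans[OF n] by blast
  qed
qed

section \<open>Extremal reversed edges\<close>

context
  fixes i p q u
  assumes flip: "(i, p, q) \<in> flips" and u: "first_write i p u"
    and u_max: "\<And>n a b v. \<lbrakk>(n, a, b) \<in> flips; first_write n a v\<rbrakk> \<Longrightarrow> (u, v) \<notin> SWO S V"
    and p_max: "\<And>a b. \<lbrakk>(i, a, b) \<in> flips; first_write i a u\<rbrakk> \<Longrightarrow> (p, a) \<notin> A i"
begin

lemma i: "i \<in> procs S"
  using flip flipsD by blast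

lemma u_props: "u \<in> writes S" "proc_of S u = i" "(p, u) \<in> (A i)\<^sup>="
  using u by (auto simp: first_write_def)

text \<open>A first write \<open>v\<close> of \<open>a\<close> strictly after \<open>w\<close> would
  be above \<open>u\<close> in \<open>SWO\<close>, against maximality. Hence a <= v <= w.\<close>

lemma flip_source_le_later_write:
  assumes f: "(n, a, b) \<in> flips" and w: "w \<in> writes S" "proc_of S w = n" "(u, w) \<in> (SWO S V)\<^sup>="
  shows "(a, w) \<in> (A n)\<^sup>="
proof -
  obtain v where v: "first_write n a v" using flip_first_write[OF f] .
  then have v': "v \<in> writes S" "proc_of S v = n" "(a, v) \<in> (A n)\<^sup>="
    by (auto simp: first_write_def)
  have "(w, v) \<notin> A n"
  proof
    assume "(w, v) \<in> A n"
    then have "(w, v) \<in> SWO S V" using v' w by (simp add: SWO_iff)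
    then have "(u, v) \<in> SWO S V" using w(3) SWO_trans by (auto dest: transD)
    then show False using u_max[OF f v] by blast
  qed
  then have "(v, w) \<in> (A n)\<^sup>=" using own_A_linear[of v w n] v' w write_op by blast
  then show ?thesis using A_le_trans v'(3) by blast
qed

lemma flip_source_le_later_write_T:
  assumes "(n, a, b) \<in> flips" "w \<in> writes S" "proc_of S w = n" "(u, w) \<in> (SWO S V)\<^sup>="
  shows "(a, w) \<in> (T n)\<^sup>="
  using A_le_own_target[OF write_op] assms flip_source_le_later_write by blast

text \<open>The first write above \<open>a\<close> is also above \<open>u\<close>, hence equals
  \<open>u\<close> by maximality. This forces \<open>n = i\<close> and \<open>a = u\<close>;
  maximality of \<open>p\<close> and uniqueness of targets give the rest.\<close>

lemma flip_above_u:
  assumes f: "(n, a, b) \<in> flips" and ua: "(u, a) \<in> (A n)\<^sup>="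
  shows "n = i \<and> a = u \<and> p = u \<and> b = q"
proof -
  note n = flipsD(1)[OF f]
  obtain v where v: "first_write n a v" using flip_first_write[OF f] .
  then have v': "v \<in> writes S" "proc_of S v = n" "(a, v) \<in> (A n)\<^sup>="
    by (auto simp: first_write_def)
  have "(u, v) \<in> (A n)\<^sup>=" using A_le_trans ua v'(3) by blast
  moreover have "(u, v) \<notin> A n" using u_max[OF f v] u_props v' by (auto simp: SWO_iff)
  ultimately have uv: "u = v" by blast
  then have ni: "n = i" using v' u_props by simp
  have "(u, u) \<notin> A n" by (rule A_irrefl[OF n])
  then have a: "a = u" using ua v'(3) uv A_trans[of n] by (auto dest: transD)
  have "(p, a) \<notin> A i" using p_max f v ni uv by blast
  then have p: "p = u" using u_props a by blast
  show ?thesis using flips_unique_target[of i p b q] f flip ni a p by blast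
qed

section \<open>\<open>C\<close> edges in the replay\<close>

abbreviation "CL \<equiv> C_level S V i p q"

text \<open>The claims are proved together: since the target is above \<open>u\<close>, it bounds
  the source of any flip met on the way, and this puts the edge into the view.\<close>

lemma C_level_SCO:
  "(a, b) \<in> CL k \<Longrightarrow> a \<in> writes S \<and> b \<in> writes S \<and> (a, b) \<in> T (proc_of S b) \<and>
     (u, b) \<in> (SWO S V)\<^sup>="
proof (induction k arbitrary: a b rule: induct_nat_012)
  case 0
  then show ?case by simp
next
  case 1
  then have w: "a \<in> writes S" "b \<in> writes S" "a \<noteq> b" "proc_of S b = i"
    "(p, b) \<in> (A i)\<^sup>=" "(a, q) \<in> (A i)\<^sup>=" by auto
  have "(u, b) \<in> (A i)\<^sup>=" using u w by (auto simp: first_write_def)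
  then have ub: "(u, b) \<in> (SWO S V)\<^sup>=" using w u_props by (auto simp: SWO_iff)
  have "(a, b) \<in> T i"
  proof (cases "(a, q) \<in> (T i)\<^sup>=")
    case True
    \<comment> \<open>The reversal of \<open>(p, q)\<close> yields a <= q < p <= b in
      \<open>T i\<close>.\<close>
    then have "(a, p) \<in> T i" using T_le_less_trans[OF i] flipsD(4)[OF flip] by blast
    moreover have "(p, b) \<in> (T i)\<^sup>=" using A_le_own_target w write_op by blast
    ultimately show ?thesis by (rule T_less_le_trans[OF i])
  next
    case False
    \<comment> \<open>The path to \<open>q\<close> leaves \<open>T i\<close> at some flip, whose
      source is at or before \<open>b\<close>.\<close>
    then have "(a, q) \<in> (A i \<union> {})\<^sup>+" using w(6) by auto
    from path_or_flip[OF i _ this] False obtain a' b' where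
      f: "(i, a', b') \<in> flips" "(a, a') \<in> (T i)\<^sup>=" by blast
    have "(a', b) \<in> (T i)\<^sup>=" by (rule flip_source_le_later_write_T[OF f(1) w(2,4) ub])
    then show ?thesis using f(2) w(3) T_less_le_trans[OF i] by blast
  qed
  then show ?case using w ub by blast
next
  case (ge2 k)
  let ?n = "proc_of S b"
  from ge2.prems have w: "a \<in> writes S" "b \<in> writes S" "a \<noteq> b" by auto
  have n: "?n \<in> procs S" by (rule write_proc[OF w(2)])
  from ge2.prems obtain w5 w6 where C: "(w5, w6) \<in> CL (Suc k)"
    and w5: "(a, w5) \<in> (A ?n \<squnion> CL (Suc k))\<^sup>=" and w6: "(w6, b) \<in> (A ?n)\<^sup>="
    by (auto simp: Let_def)
  note IH = ge2.IH(2)[OF C]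
  have CT: "CL (Suc k) \<subseteq> T ?n"
    by (intro subrelI) (use ge2.IH(2) T_own_target[OF _ _ _ n] in blast)
  have "(w6, b) \<in> (SWO S V)\<^sup>=" using w6 IH w by (auto simp: SWO_iff)
  then have ub: "(u, b) \<in> (SWO S V)\<^sup>=" using IH SWO_trans by (auto dest: transD)
  have "(a, b) \<in> T ?n"
  proof (cases "(a, w5) \<in> (T ?n)\<^sup>=")
    case True
    have "(w5, w6) \<in> T ?n" using C CT by blast
    moreover have "(w6, b) \<in> (T ?n)\<^sup>=" using A_le_own_target w6 w write_op by blast
    ultimately show ?thesis using True T_less_le_trans[OF n] T_le_less_trans[OF n] by blast
  next
    case False
    then have "(a, w5) \<in> (A ?n \<union> CL (Suc k))\<^sup>+" using w5 by (auto simp: tjoin_def rtrancl_eq_or_trancl)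
    from path_or_flip[OF n CT this] False obtain a' b' where
      f: "(?n, a', b') \<in> flips" "(a, a') \<in> (T ?n)\<^sup>=" by blast
    have "(a', b) \<in> (T ?n)\<^sup>=" by (rule flip_source_le_later_write_T[OF f(1) w(2) refl ub])
    then show ?thesis using f(2) w(3) T_less_le_trans[OF n] by blast
  qed
  then show ?case using w ub by blast
qed

lemma C_level_subset_T: "m \<in> procs S \<Longrightarrow> CL k \<subseteq> T m"
  by (rule subrelI) (use C_level_SCO T_own_target in blast)

lemma C_level_target_above_u:
  assumes "m \<in> procs S" "(a, b) \<in> CL k"
  shows "(u, b) \<in> (A m)\<^sup>="
  using C_level_SCO[OF assms(2)] SWO_subset_A[OF assms(1)] by blast

lemma C_level_irrefl: "(a, a) \<notin> CL k"
  using C_level_SCO[of a a k] T.view_irrefl write_proc by blast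

text \<open>\<open>A\<close> edges preserve being above \<open>u\<close> by transitivity, and the
  target of a \<open>C\<close> edge is above \<open>u\<close> whatever its source.\<close>

lemma above_u_closed:
  assumes m: "m \<in> procs S" and X: "X \<subseteq> (\<Union>k. CL k)"
    and "(x, z) \<in> (A m \<union> X)\<^sup>*" "(u, x) \<in> (A m)\<^sup>="
  shows "(u, z) \<in> (A m)\<^sup>="
  using assms(3)
proof (induction rule: rtrancl_induct)
  case base
  show ?case by (rule assms(4))
next
  case (step y z)
  then consider "(y, z) \<in> A m" | k where "(y, z) \<in> CL k" using X by blast
  then show ?case
  proof cases
    case 1
    then show ?thesis using A_le_trans step.IH by blast
  next
    case 2
    then show ?thesis using C_level_target_above_u[OF m] by blast
  qed
qed

text \<open>Otherwise some flip would have its source strictly above \<open>u\<close>, which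
  \<open>flip_above_u\<close> excludes.\<close>

lemma A_above_u_in_T:
  assumes "(u, z) \<in> A i" "(z, b) \<in> A i"
  shows "(z, b) \<in> T i"
proof (rule ccontr)
  assume "(z, b) \<notin> T i"
  moreover have "(z, b) \<in> (A i \<union> {})\<^sup>+" using assms by auto
  ultimately obtain a' b' where f: "(i, a', b') \<in> flips" "(z, a') \<in> (A i \<union> {})\<^sup>*"
    using path_or_flip[OF i empty_subsetI] by blast
  have "(z, a') \<in> (A i)\<^sup>=" using f(2) by (simp add: rtrancl_eq_or_trancl trancl_id A_trans) blast
  then have "(u, a') \<in> A i" using assms A_trans[of i] by (auto dest: transD)
  moreover from this have "a' = u" using flip_above_u[OF f(1)] by blast
  ultimately show False using A_irrefl[OF i] by blast
qed

text \<open>Prepares the detour around \<open>p\<close>. At the base level a <= q holds in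
  \<open>A i\<close> and survives above \<open>u\<close>; higher levels reduce to a lower-level
  \<open>C\<close> edge into \<open>u\<close>.\<close>

lemma C_level_into_u:
  assumes "(u, a) \<in> A i" "(a, u) \<in> CL k" and p: "p = u"
  shows "(a, q) \<in> (T i)\<^sup>="
  using assms(1,2)
proof (induction k arbitrary: a rule: induct_nat_012)
  case 0
  then show ?case by simp
next
  case 1
  then show ?case using A_above_u_in_T by auto
next
  case (ge2 k)
  obtain w5 w6 where C: "(w5, w6) \<in> CL (Suc k)"
    and w5: "(a, w5) \<in> (A i \<squnion> CL (Suc k))\<^sup>=" and w6: "(w6, u) \<in> (A i)\<^sup>="
    using ge2.prems(2) u_props by (auto simp: Let_def)
  have "(u, w6) \<in> (A i)\<^sup>=" by (rule C_level_target_above_u[OF i C])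
  then have "w6 = u" using w6 A_irrefl[OF i] A_trans[of i] by (auto dest: transD)
  with C have C: "(w5, u) \<in> CL (Suc k)" by simp
  have path: "(a, w5) \<in> (A i \<union> CL (Suc k))\<^sup>*"
    using w5 by (auto simp: tjoin_def trancl_into_rtrancl)
  have above: "(u, z) \<in> (A i)\<^sup>=" if "(a, z) \<in> (A i \<union> CL (Suc k))\<^sup>*" for z
    by (rule above_u_closed[OF i _ that]) (use ge2.prems in auto)
  \<comment> \<open>Until a <= q is known, the path stays in \<open>T i\<close> and avoids
    \<open>u\<close>. An edge entering \<open>u\<close> starts strictly above \<open>u\<close>, so
    it is a \<open>C\<close> edge and the induction hypothesis applies.\<close>
  from path have "(a, q) \<in> (T i)\<^sup>= \<or> (w5 \<noteq> u \<and> (a, w5) \<in> (T i)\<^sup>=)"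
  proof (induction rule: rtrancl_induct)
    case base
    then show ?case using ge2.prems A_irrefl[OF i] by blast
  next
    case (step y z)
    show ?case
    proof (cases "(a, q) \<in> (T i)\<^sup>=")
      case False
      with step.IH have y: "y \<noteq> u" "(a, y) \<in> (T i)\<^sup>=" by blast+
      then have uy: "(u, y) \<in> A i" using above[OF step(1)] by blast
      then have "(y, z) \<in> T i" using step(2) A_above_u_in_T C_level_subset_T[OF i] by blast
      moreover have "z \<noteq> u"
      proof
        assume "z = u"
        moreover have "(y, u) \<notin> A i" using uy A_irrefl[OF i] A_trans[of i] by (auto dest: transD)
        ultimately have "(y, q) \<in> (T i)\<^sup>=" using step(2) ge2.IH(2)[OF uy] by blast
        then show False using False y(2) T_less_le_trans[OF i] by blast
      qed
      ultimately show ?thesis using y(2) T_le_less_trans[OF i] by blast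
    qed blast
  qed
  moreover have "(a, q) \<in> (T i)\<^sup>=" if "w5 \<noteq> u" "(a, w5) \<in> (T i)\<^sup>="
  proof -
    have "(u, w5) \<in> A i" using above[OF path] that by blast
    then show ?thesis using ge2.IH(2) C that(2) T_less_le_trans[OF i] by blast
  qed
  ultimately show ?case by blast
qed

section \<open>Cycles formed by \<open>A\<close> and \<open>C\<close> edges\<close>

abbreviation "CR \<equiv> C_rel S V i p q"

lemma C_rel_levels: "CR \<subseteq> (\<Union>k. CL k)"
  by (auto simp: C_rel_def)

lemma C_rel_subset_T: "m \<in> procs S \<Longrightarrow> CR \<subseteq> T m"
  using C_rel_levels C_level_subset_T by blast

text \<open>Since \<open>A m\<close> is acyclic, the cycle has a \<open>C\<close> edge; it is
  restarted at the target of that edge. \<open>Y\<close> stands for \<open>A m\<close> or for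
  \<open>A i\<close> without \<open>(p, q)\<close>.\<close>

lemma cycle_through_C:
  assumes m: "m \<in> procs S" and x: "(x, x) \<in> (Y \<union> CR)\<^sup>+" and Y: "Y \<subseteq> A m"
  obtains w where "(w, w) \<in> (Y \<union> CR)\<^sup>+" "(u, w) \<in> (A m)\<^sup>="
proof -
  have "(x, z) \<in> A m \<or> (\<exists>a w. (x, a) \<in> (Y \<union> CR)\<^sup>* \<and> (a, w) \<in> CR \<and> (w, z) \<in> (Y \<union> CR)\<^sup>*)"
    if "(x, z) \<in> (Y \<union> CR)\<^sup>+" for z
    using that
  proof (induction rule: trancl_induct)
    case (base y)
    then show ?case using Y by blast
  next
    case (step y z)
    show ?case
    proof (cases "(y, z) \<in> CR")
      case True
      then show ?thesis using step(1) by (meson rtrancl.rtrancl_refl trancl_into_rtrancl)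
    next
      case False
      then have "(y, z) \<in> A m" using step(2) Y by blast
      then show ?thesis using step.IH step(2) A_trans[of m]
        by (meson rtrancl.rtrancl_into_rtrancl transD)
    qed
  qed
  from this[OF x] obtain a w where aw: "(x, a) \<in> (Y \<union> CR)\<^sup>*" "(a, w) \<in> CR"
      "(w, x) \<in> (Y \<union> CR)\<^sup>*"
    using A_irrefl[OF m] by blast
  have "(w, a) \<in> (Y \<union> CR)\<^sup>*" using aw(1,3) by (meson rtrancl_trans)
  then have "(w, w) \<in> (Y \<union> CR)\<^sup>+" using aw(2) by (meson UnI2 rtrancl_into_trancl1)
  moreover have "(u, w) \<in> (A m)\<^sup>="
    using aw(2) C_rel_levels C_level_target_above_u[OF m] by blast
  ultimately show thesis by (rule that)
qed

text \<open>A cycle cannot lie in the strict order \<open>T m\<close>, so it meets a flip, whose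
  source is above \<open>u\<close>.\<close>

lemma cycle_flip:
  assumes m: "m \<in> procs S" and x: "(x, x) \<in> (A m \<union> CR)\<^sup>+"
  shows "m = i \<and> p = u"
proof -
  obtain w where w: "(w, w) \<in> (A m \<union> CR)\<^sup>+" "(u, w) \<in> (A m)\<^sup>="
    using cycle_through_C[OF m x order_refl] .
  from path_or_flip[OF m C_rel_subset_T[OF m] w(1)] T.view_irrefl[OF m]
  obtain a b where f: "(m, a, b) \<in> flips" "(w, a) \<in> (A m \<union> CR)\<^sup>*" by blast
  have "(u, a) \<in> (A m)\<^sup>=" by (rule above_u_closed[OF m C_rel_levels f(2) w(2)])
  then show ?thesis using flip_above_u[OF f(1)] by blast
qed

text \<open>When \<open>p = u\<close>, a cycle through \<open>p\<close> enters it by a \<open>C\<close> edge whose source precedes \<open>q\<close> in the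
  replayed view, and the target of every edge leaving \<open>p\<close> other than the flipped one comes after \<open>q\<close>
  there, so that \<open>p\<close> can be replaced by \<open>q\<close>.\<close>

lemma acyclic_without_flip:
  assumes p: "p = u"
  shows "acyclic ((A i - {(p, q)}) \<union> CR)"
proof (rule acyclicI, rule allI, rule notI)
  let ?Y = "(A i - {(p, q)}) \<union> CR"
  fix x0 assume x0: "(x0, x0) \<in> ?Y\<^sup>+"
  obtain w where w: "(w, w) \<in> ?Y\<^sup>+" "(u, w) \<in> (A i)\<^sup>="
    using cycle_through_C[OF i x0] by blast
  have irrefl: "(a, a) \<notin> ?Y" for a
    using A_irrefl[OF i] C_rel_levels C_level_irrefl by blast
  have sub: "?Y\<^sup>* \<subseteq> (A i \<union> CR)\<^sup>*" by (rule rtrancl_mono) blast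
  \<comment> \<open>A cycle based at \<open>u\<close> is rotated to its next vertex, so that the
    base point is not the one replaced by \<open>q\<close>.\<close>
  have "\<exists>x. x \<noteq> u \<and> (u, x) \<in> (A i)\<^sup>= \<and> (x, x) \<in> ?Y\<^sup>+"
  proof (cases "w = u")
    case True
    from w(1) obtain b where b: "(w, b) \<in> ?Y" "(b, w) \<in> ?Y\<^sup>*"
      by (meson tranclD)
    then have "(b, b) \<in> ?Y\<^sup>+" by (meson rtrancl_into_trancl1)
    moreover have "(u, b) \<in> (A i)\<^sup>="
      by (rule above_u_closed[OF i C_rel_levels _ w(2)]) (use b(1) in blast)
    moreover have "b \<noteq> u" using b(1) irrefl True by blast
    ultimately show ?thesis by blast
  next
    case False
    then show ?thesis using w by blast
  qed
  then obtain x where x: "x \<noteq> u" "(u, x) \<in> (A i)\<^sup>=" "(x, x) \<in> ?Y\<^sup>+" by blast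
  have above: "(u, z) \<in> (A i)\<^sup>=" if "(x, z) \<in> ?Y\<^sup>*" for z
    by (rule above_u_closed[OF i C_rel_levels _ x(2)]) (use that sub in blast)
  have qu: "(q, u) \<in> T i" using flipsD(4)[OF flip] p by simp
  have into: "(y, q) \<in> (T i)\<^sup>=" if "(y, u) \<in> ?Y" "y \<noteq> u" "(u, y) \<in> (A i)\<^sup>=" for y
  proof -
    have uy: "(u, y) \<in> A i" using that by blast
    then have "(y, u) \<notin> A i" using A_irrefl[OF i] A_trans[of i] by (auto dest: transD)
    then show ?thesis using that C_rel_levels C_level_into_u[OF uy _ p] by blast
  qed
  have out: "(u, z) \<in> T i \<or> (q, z) \<in> T i" if "(u, z) \<in> ?Y" for z
  proof (cases "(u, z) \<in> CR")
    case True
    then show ?thesis using C_rel_subset_T[OF i] by blast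
  next
    case False
    \<comment> \<open>As \<open>(p, q)\<close> was removed, z differs from q; a path to z that
      starts with the reversed covering edge therefore goes on from q.\<close>
    then have uz: "(u, z) \<in> A i" "z \<noteq> q" using that p by auto
    then have "(u, z) \<in> (A_red i)\<^sup>+" by (simp add: A_red_trancl[OF i])
    then obtain c where c: "(u, c) \<in> A_red i" "(c, z) \<in> (A_red i)\<^sup>*" by (meson tranclD)
    then have uc: "(u, c) \<in> A i" by (simp add: A_red_eq[OF i])
    have "c = z \<or> (c, z) \<in> A i"
      using c(2) by (auto simp: rtrancl_eq_or_trancl A_red_trancl[OF i])
    then have cz: "(c, z) \<in> (T i)\<^sup>=" using A_above_u_in_T[OF uc] by blast
    show ?thesis
    proof (cases "(u, c) \<in> T i")
      case True
      then show ?thesis using cz T_less_le_trans[OF i] by blast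
    next
      case False
      then have "(i, u, c) \<in> flips" using c(1) i by (simp add: flips_def)
      then have "c = q" using flip_above_u by blast
      then show ?thesis using cz uz(2) by blast
    qed
  qed
  \<comment> \<open>Invariant of the walk in \<open>T i\<close>, with \<open>q\<close> standing in
    for each visit to \<open>u\<close>.\<close>
  have walk: "if z = u then (x, q) \<in> (T i)\<^sup>= else (x, z) \<in> T i"
    if "(x, y) \<in> ?Y\<^sup>*" "(y, z) \<in> ?Y" and
      y: "if y = u then (x, q) \<in> (T i)\<^sup>= else (x, y) \<in> (T i)\<^sup>=" for y z
  proof (cases "y = u")
    case True
    then have "z \<noteq> u" using that irrefl by blast
    moreover have "(q, z) \<in> T i"
      using out[of z] that(2) True qu T_less_le_trans[OF i] by blast
    ultimately show ?thesis using y True T_le_less_trans[OF i] by auto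
  next
    case False
    then have xy: "(x, y) \<in> (T i)\<^sup>=" and uy: "(u, y) \<in> A i" using y above[OF that(1)] by auto
    show ?thesis
    proof (cases "z = u")
      case True
      then have "(y, q) \<in> (T i)\<^sup>=" using into that(2) False uy by blast
      then show ?thesis using xy True T_less_le_trans[OF i] by auto
    next
      case False
      have "(y, z) \<in> T i"
        using that(2) A_above_u_in_T[OF uy] C_rel_subset_T[OF i] by blast
      then show ?thesis using xy False T_le_less_trans[OF i] by auto
    qed
  qed
  have "if z = u then (x, q) \<in> (T i)\<^sup>= else (x, z) \<in> T i" if "(x, z) \<in> ?Y\<^sup>+" for z
    using that
  proof (induction rule: trancl_induct)
    case (base y)
    then show ?case using walk[of x y] x(1) by auto
  next
    case (step y z)
    then show ?case using walk[of y z]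
      by (auto simp: trancl_into_rtrancl split: if_splits)
  qed
  from this[OF x(3)] show False using x(1) T.view_irrefl[OF i] by auto
qed

lemma extremal_flip_False: False
proof -
  from flipsD(3)[OF flip] obtain m where m: "m \<in> procs S"
    and "m \<noteq> i \<and> \<not> acyclic (A m \<union> CR) \<or> m = i \<and> \<not> acyclic ((A i - {(p, q)}) \<union> CR)"
    by (auto simp: B_rel_def)
  then consider "m \<noteq> i" "\<not> acyclic (A m \<union> CR)" | "\<not> acyclic ((A i - {(p, q)}) \<union> CR)" by blast
  then show False
  proof cases
    case 1
    then show ?thesis using cycle_flip[OF m] by (auto simp: acyclic_def)
  next
    case 2
    then have "\<not> acyclic (A i \<union> CR)" by (rule contrapos_nn) (erule acyclic_subset, blast)
    then have "p = u" using cycle_flip[OF i] by (auto simp: acyclic_def)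
    with 2 show ?thesis using acyclic_without_flip by blast
  qed
qed

end

section \<open>Survival of all covering edges\<close>

lemma flips_empty: "flips = {}"
proof (rule ccontr)
  assume "flips \<noteq> {}"
  then obtain n a b where f: "(n, a, b) \<in> flips" by auto
  obtain v where v: "first_write n a v" using flip_first_write[OF f] .
  let ?W = "{v. \<exists>n a b. (n, a, b) \<in> flips \<and> first_write n a v}"
  have "finite ?W"
    by (rule finite_subset[OF _ finite_ops]) (auto simp: first_write_def writes_def)
  moreover have "irrefl (SWO S V)"
    using SWO_subset_A A_irrefl write_proc SWO_writes by (fastforce simp: irrefl_def)
  moreover have "v \<in> ?W" using f v by blast
  ultimately obtain u where u: "u \<in> ?W" "\<And>z. z \<in> ?W \<Longrightarrow> (u, z) \<notin> SWO S V"
    by (rule finite_maximal_rel[OF _ SWO_trans]) (rule that)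
  then obtain i p q where f1: "(i, p, q) \<in> flips" "first_write i p u" by blast
  note i = flipsD(1)[OF f1(1)]
  let ?P = "{p. \<exists>q. (i, p, q) \<in> flips \<and> first_write i p u}"
  have "finite ?P"
  proof (rule finite_subset[OF _ finite_ops], rule subsetI)
    fix a assume "a \<in> ?P"
    then obtain b where "(a, b) \<in> A i" using flipsD by blast
    then show "a \<in> ops S" using A_view_dom[OF i] view_dom_ops[of i] by blast
  qed
  moreover have "irrefl (A i)" using A_irrefl[OF i] by (simp add: irrefl_def)
  moreover have "p \<in> ?P" using f1 by blast
  ultimately obtain p' where p': "p' \<in> ?P" "\<And>z. z \<in> ?P \<Longrightarrow> (p', z) \<notin> A i"
    by (rule finite_maximal_rel[OF _ A_trans]) (rule that)
  then obtain q' where "(i, p', q') \<in> flips" "first_write i p' u" by blast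
  then show False
  proof (rule extremal_flip_False)
    show "(u, v) \<notin> SWO S V" if "(n, a, b) \<in> flips" "first_write n a v" for n a b v
      using u(2)[of v] that by blast
    show "(p', a) \<notin> A i" if "(i, a, b) \<in> flips" "first_write i a u" for a b
      using p'(2)[of a] that by blast
  qed
qed

text \<open>As all covering edges survive, \<open>DRO S (V i)\<close> lies in \<open>T i\<close>;
  totality of the views gives equality.\<close>

lemma DRO_replay:
  assumes i: "i \<in> procs S"
  shows "DRO S (T i) = DRO S (V i)"
proof -
  have "A_red i \<subseteq> T i" using flips_empty i by (auto simp: flips_def)
  then have "(A_red i)\<^sup>+ \<subseteq> T i"
    by (metis trancl_mono_subset trancl_id T.view_trans[OF i])
  then have le: "DRO S (V i) \<subseteq> T i" using A_DRO A_red_trancl[OF i] by blast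
  show ?thesis
  proof
    show "DRO S (V i) \<subseteq> DRO S (T i)" using le by (auto simp: DRO_iff[OF i] T.DRO_iff[OF i])
    show "DRO S (T i) \<subseteq> DRO S (V i)"
    proof (rule subrelI)
      fix a b assume ab: "(a, b) \<in> DRO S (T i)"
      then have T: "(a, b) \<in> T i" "var_of S a = var_of S b" by (auto simp: T.DRO_iff[OF i])
      have nT: "(b, a) \<notin> T i" using T(1) T.view_trans[OF i] T.view_irrefl[OF i]
        by (blast dest: transD)
      have "a \<noteq> b" using T(1) T.view_irrefl[OF i] by blast
      then have "(a, b) \<in> V i \<or> (b, a) \<in> V i" using view_linear[OF i] T.view_dom[OF i T(1)] by blast
      moreover have "(b, a) \<notin> DRO S (V i)" using nT le by blast
      then have "(b, a) \<notin> V i" using T(2) by (simp add: DRO_iff[OF i])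
      ultimately show "(a, b) \<in> DRO S (V i)" using T(2) by (simp add: DRO_iff[OF i])
    qed
  qed
qed

end

lemma explains_causal_views:
  assumes "wf_system S" "explains_strongly_causal S V"
  shows "causal_views S V"
  using assms
  by unfold_locales (auto simp: explains_strongly_causal_def explains_def is_view_def respects_rel_def)

theorem theorem6p6:
  fixes S :: "('p, 'x, 'v, 'o) system"
    and V R :: "'p \<Rightarrow> 'o rel"
  assumes "wf_system S"
    and "explains_strongly_causal S V"
    and "\<And>i. i \<in> procs S \<Longrightarrow>
      R i = transitive_reduction (A_rel S V i) - (SWO_foreign S V i \<union> PO S \<union> B_rel S V i)"
  shows "good_record S V R \<and>
    (\<forall>V'. explains_strongly_causal S V' \<and> (\<forall>i\<in>procs S. R i \<subseteq> V' i) \<longrightarrow>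
      (\<forall>i\<in>procs S. DRO S (V' i) = DRO S (V i)))"
proof -
  interpret V: causal_views S V by (rule explains_causal_views[OF assms(1,2)])
  have "DRO S (V' i) = DRO S (V i)"
    if "explains_strongly_causal S V'" "\<forall>i\<in>procs S. R i \<subseteq> V' i" "i \<in> procs S" for V' i
  proof -
    interpret T: causal_views S V' by (rule explains_causal_views[OF assms(1) that(1)])
    interpret replay S V V' by unfold_locales (use that(2) assms(3) in blast)
    show ?thesis by (rule DRO_replay[OF that(3)])
  qed
  \<comment> \<open>Outside \<open>SWO\<close> and program order, a covering edge is a
    \<open>DRO\<close> generator.\<close>
  moreover have "is_record S V R"
    using V.A_red_subset by (fastforce simp: is_record_def assms(3))
  ultimately show ?thesis by (auto simp: good_record_def certifies_replay_def)
qed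

end
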